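(* The primitive $DS$-triples which satisfy $c_{4,-}=0$ are precisely the triples $[M^2,\,N^2,\,(M+N)^2]$ with integers $1\le M\le N$ and $\gcd(M,N)=1$; for these, $4q=c_{4,+}=2\left(M^2+N^2+(M+N)^2\right)$.
   Context: For integers $0<c_1\le c_2\le c_3$ put $q=\sqrt{c_1c_2+c_1c_3+c_2c_3}>0$ and $c_{4,\pm}=c_1+c_2+c_3\pm 2q$. The triple $[c_1,c_2,c_3]$ is called a $DS$-triple (Descartes-Steiner triple) if both $c_{4,+}$ and $c_{4,-}$ are integers (equivalently, $q$ is an integer), and a primitive $DS$-triple if moreover $\gcd(c_1,c_2,c_3)=1$. *)

theory Defs
  imports Complex_Main
begin

definition ds_q :: "int \<Rightarrow> int \<Rightarrow> int \<Rightarrow> real" where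
  "ds_q c1 c2 c3 = sqrt (of_int (c1 * c2 + c1 * c3 + c2 * c3))"

definition c4_plus :: "int \<Rightarrow> int \<Rightarrow> int \<Rightarrow> real" where
  "c4_plus c1 c2 c3 = of_int (c1 + c2 + c3) + 2 * ds_q c1 c2 c3"

definition c4_minus :: "int \<Rightarrow> int \<Rightarrow> int \<Rightarrow> real" where
  "c4_minus c1 c2 c3 = of_int (c1 + c2 + c3) - 2 * ds_q c1 c2 c3"

definition DS_triple :: "int \<Rightarrow> int \<Rightarrow> int \<Rightarrow> bool" where
  "DS_triple c1 c2 c3 \<longleftrightarrow>
     0 < c1 \<and> c1 \<le> c2 \<and> c2 \<le> c3 \<and> c4_plus c1 c2 c3 \<in> \<int> \<and> c4_minus c1 c2 c3 \<in> \<int>"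

definition primitive_DS_triple :: "int \<Rightarrow> int \<Rightarrow> int \<Rightarrow> bool" where
  "primitive_DS_triple c1 c2 c3 \<longleftrightarrow> DS_triple c1 c2 c3 \<and> gcd c1 (gcd c2 c3) = 1"

end

theory Submission
  imports Defs
begin

text \<open>
  Squaring turns the irrational equation \<open>c4_minus c1 c2 c3 = 0\<close> into
  \<open>(c1 + c2 + c3)\<^sup>2 = 4 * (c1 * c2 + c1 * c3 + c2 * c3)\<close>, which completes to
  \<open>(c3 - c1 - c2)\<^sup>2 = 4 * c1 * c2\<close>. A common divisor of \<open>c1\<close> and \<open>c2\<close> therefore divides
  \<open>c3\<close> as well, so primitivity forces \<open>c1\<close> and \<open>c2\<close> to be coprime. Since their
  product is a square, each is a square, say \<open>M\<^sup>2\<close> and \<open>N\<^sup>2\<close>. The equation then leaves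
  \<open>c3 = (N + M)\<^sup>2\<close> or \<open>c3 = (N - M)\<^sup>2\<close>, and the second value is smaller than \<open>N\<^sup>2\<close>, against
  the ordering of the triple.

  Conversely, these triples satisfy the completed equation, and integrality is automatic: once
  \<open>c4_minus\<close> vanishes, \<open>2 * ds_q\<close> equals the sum of the triple, so \<open>c4_plus\<close> is twice that
  sum.
\<close>

text \<open>
  Positivity of the sum is what makes squaring reversible. Completing the square in \<open>c3\<close> leaves
  a right-hand side free of \<open>c3\<close>, which exposes \<open>c1 * c2\<close> as a square.
\<close>
lemma c4_minus_eq_0_iff:
  assumes "0 < c1 + c2 + c3"
  shows "c4_minus c1 c2 c3 = 0 \<longleftrightarrow> (c3 - c1 - c2)\<^sup>2 = 4 * (c1 * c2)"
proof -
  define s where "s = c1 + c2 + c3"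
  define e where "e = c1 * c2 + c1 * c3 + c2 * c3"
  have s: "0 < s" using assms by (simp add: s_def)
  have "c4_minus c1 c2 c3 = 0 \<longleftrightarrow> sqrt (of_int e) = of_int s / 2"
    by (auto simp: c4_minus_def ds_q_def s_def e_def)
  also have "\<dots> \<longleftrightarrow> of_int e = (of_int s / 2 :: real)\<^sup>2"
  proof
    assume eq: "sqrt (of_int e) = of_int s / 2"
    have "0 < sqrt (of_int e)" unfolding eq using s by simp
    then have "0 \<le> (of_int e :: real)" by simp
    then show "of_int e = (of_int s / 2 :: real)\<^sup>2"
      using eq by (metis real_sqrt_pow2)
  next
    assume "of_int e = (of_int s / 2 :: real)\<^sup>2"
    then show "sqrt (of_int e) = of_int s / 2" using s by simp
  qed
  also have "\<dots> \<longleftrightarrow> (of_int (s\<^sup>2) :: real) = of_int (4 * e)"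
    by (auto simp: power_divide)
  also have "\<dots> \<longleftrightarrow> s\<^sup>2 = 4 * e" by (rule of_int_eq_iff)
  also have "\<dots> \<longleftrightarrow> (c3 - c1 - c2)\<^sup>2 = 4 * (c1 * c2)"
    unfolding s_def e_def by (auto simp: power2_eq_square algebra_simps)
  finally show ?thesis .
qed

lemma c4_plus_of_c4_minus_eq_0:
  assumes "c4_minus c1 c2 c3 = 0"
  shows "4 * ds_q c1 c2 c3 = c4_plus c1 c2 c3"
    and "c4_plus c1 c2 c3 = of_int (2 * (c1 + c2 + c3))"
  using assms by (auto simp: c4_minus_def c4_plus_def)

text \<open>
  The root of \<open>a\<close> can be named outright as \<open>gcd a e\<close>: its square is
  \<open>gcd (a\<^sup>2) (e\<^sup>2) = gcd (a * a) (a * b)\<close>, in which \<open>a\<close> factors out.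
\<close>
lemma coprime_factor_of_square:
  fixes a b e :: int
  assumes "coprime a b" "0 < a" "a * b = e\<^sup>2"
  shows "a = (gcd a e)\<^sup>2"
proof -
  have "(gcd a e)\<^sup>2 = gcd (a\<^sup>2) (e\<^sup>2)" by (simp add: gcd_exp)
  also have "\<dots> = gcd (a * a) (a * b)"
    by (simp add: assms(3) power2_eq_square[of a])
  also have "\<dots> = a"
    using assms(1,2) by (simp add: gcd_mult_left)
  finally show ?thesis ..
qed

text \<open>
  A common divisor \<open>g\<close> of \<open>c1\<close> and \<open>c2\<close> has \<open>g\<^sup>2 dvd (c3 - c1 - c2)\<^sup>2\<close>, and square roots
  preserve divisibility, so \<open>g\<close> also divides \<open>c3\<close>.
\<close>
lemma coprime_of_primitive_square:
  fixes c1 c2 c3 :: int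
  assumes sq: "(c3 - c1 - c2)\<^sup>2 = 4 * (c1 * c2)" and prim: "gcd c1 (gcd c2 c3) = 1"
  shows "coprime c1 c2"
proof -
  define g where "g = gcd c1 c2"
  have g: "g dvd c1" "g dvd c2" by (simp_all add: g_def)
  then have "g\<^sup>2 dvd c1 * c2" unfolding power2_eq_square by (rule mult_dvd_mono)
  then have "g\<^sup>2 dvd (c3 - c1 - c2)\<^sup>2" unfolding sq by (rule dvd_mult)
  then have "g dvd c3 - c1 - c2" by (simp add: pow_divides_pow_iff)
  with g have "g dvd (c3 - c1 - c2) + c1 + c2" by (intro dvd_add)
  then have "g dvd c3" by simp
  with g have "g dvd gcd c1 (gcd c2 c3)" by (intro gcd_greatest)
  with prim have "is_unit g" by simp
  then show ?thesis by (simp add: g_def coprime_iff_gcd_eq_1)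
qed

lemma primitive_square_imp_parametrized:
  fixes c1 c2 c3 :: int
  assumes ord: "0 < c1" "c1 \<le> c2" "c2 \<le> c3"
    and sq: "(c3 - c1 - c2)\<^sup>2 = 4 * (c1 * c2)" and prim: "gcd c1 (gcd c2 c3) = 1"
  obtains M N where "1 \<le> M" "M \<le> N" "gcd M N = 1"
    "c1 = M\<^sup>2" "c2 = N\<^sup>2" "c3 = (M + N)\<^sup>2"
proof -
  have cop: "coprime c1 c2" using coprime_of_primitive_square[OF sq prim] .
  have "even ((c3 - c1 - c2)\<^sup>2)" unfolding sq by simp
  then have "even (c3 - c1 - c2)" by simp
  then obtain e where e: "c3 - c1 - c2 = 2 * e" by (elim evenE)
  have prod: "c1 * c2 = e\<^sup>2" using sq unfolding e by (simp add: power2_eq_square)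
  define M where "M = gcd c1 e"
  define N where "N = gcd c2 e"
  have c1: "c1 = M\<^sup>2"
    unfolding M_def using cop ord(1) prod by (rule coprime_factor_of_square)
  have c2: "c2 = N\<^sup>2"
    unfolding N_def
  proof (rule coprime_factor_of_square)
    show "coprime c2 c1" using cop by (simp add: coprime_commute)
    show "0 < c2" using ord by simp
    show "c2 * c1 = e\<^sup>2" using prod by (simp add: mult.commute)
  qed
  have pos: "1 \<le> M" "1 \<le> N"
    using ord by (simp_all add: M_def N_def int_one_le_iff_zero_less)
  have le: "M \<le> N"
    using ord(2) pos unfolding c1 c2 by (simp add: power2_le_iff_abs_le)
  have copMN: "gcd M N = 1"
    using cop unfolding c1 c2 by (simp flip: coprime_iff_gcd_eq_1)
  have "e\<^sup>2 = (M * N)\<^sup>2" using prod unfolding c1 c2 by (simp add: power_mult_distrib)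
  then consider "e = M * N" | "e = - (M * N)" by (auto simp: power2_eq_iff)
  then have "e = M * N"
  proof cases
    case 2
    \<comment> \<open>Here \<open>c3 = (N - M)\<^sup>2\<close> with \<open>0 \<le> N - M < N\<close>, so \<open>c3 < c2\<close>.\<close>
    have "c3 = (N - M)\<^sup>2"
      using e unfolding 2 c1 c2 by (simp add: power2_eq_square algebra_simps)
    moreover have "(N - M)\<^sup>2 < N\<^sup>2" using le pos by (intro power_strict_mono) auto
    ultimately show ?thesis using ord(3) c2 by simp
  qed
  then have "c3 = (M + N)\<^sup>2"
    using e unfolding c1 c2 by (simp add: power2_eq_square algebra_simps)
  with pos(1) le copMN c1 c2 show thesis by (rule that)
qed

lemma c4_minus_parametrized:
  fixes M N :: int
  assumes "1 \<le> M" "M \<le> N"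
  shows "c4_minus (M\<^sup>2) (N\<^sup>2) ((M + N)\<^sup>2) = 0"
proof -
  have "0 < M\<^sup>2 + N\<^sup>2 + (M + N)\<^sup>2"
    using assms by (intro add_pos_pos) auto
  moreover have "((M + N)\<^sup>2 - M\<^sup>2 - N\<^sup>2)\<^sup>2 = 4 * (M\<^sup>2 * N\<^sup>2)"
    by (simp add: power2_eq_square algebra_simps)
  ultimately show ?thesis by (simp add: c4_minus_eq_0_iff)
qed

lemma primitive_DS_triple_parametrized:
  fixes M N :: int
  assumes "1 \<le> M" "M \<le> N" "gcd M N = 1"
  shows "primitive_DS_triple (M\<^sup>2) (N\<^sup>2) ((M + N)\<^sup>2)"
proof -
  have zero: "c4_minus (M\<^sup>2) (N\<^sup>2) ((M + N)\<^sup>2) = 0"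
    using assms by (intro c4_minus_parametrized)
  have "c4_plus (M\<^sup>2) (N\<^sup>2) ((M + N)\<^sup>2) \<in> \<int>"
    unfolding c4_plus_of_c4_minus_eq_0(2)[OF zero] by (rule Ints_of_int)
  moreover have "gcd (M\<^sup>2) (N\<^sup>2) = 1"
    using assms(3) by (simp add: gcd_exp)
  then have "gcd (M\<^sup>2) (gcd (N\<^sup>2) ((M + N)\<^sup>2)) = 1"
    by (simp flip: gcd.assoc)
  moreover have "M\<^sup>2 \<le> N\<^sup>2" "N\<^sup>2 \<le> (M + N)\<^sup>2"
    using assms by (auto intro: power_mono)
  moreover have "0 < M\<^sup>2" using assms by simp
  ultimately show ?thesis
    by (simp add: primitive_DS_triple_def DS_triple_def zero)
qed

theorem proposition5:
  shows "{(c1, c2, c3). primitive_DS_triple c1 c2 c3 \<and> c4_minus c1 c2 c3 = 0} =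
         {(M\<^sup>2, N\<^sup>2, (M + N)\<^sup>2) | M N :: int. 1 \<le> M \<and> M \<le> N \<and> gcd M N = 1} \<and>
         (\<forall>M N :: int. 1 \<le> M \<and> M \<le> N \<and> gcd M N = 1 \<longrightarrow>
           4 * ds_q (M\<^sup>2) (N\<^sup>2) ((M + N)\<^sup>2) = c4_plus (M\<^sup>2) (N\<^sup>2) ((M + N)\<^sup>2) \<and>
           c4_plus (M\<^sup>2) (N\<^sup>2) ((M + N)\<^sup>2) = of_int (2 * (M\<^sup>2 + N\<^sup>2 + (M + N)\<^sup>2)))"
    (is "?L = ?R \<and> ?formula")
proof
  show "?L = ?R"
  proof
    show "?L \<subseteq> ?R"
    proof clarify
      fix c1 c2 c3
      assume "primitive_DS_triple c1 c2 c3" and zero: "c4_minus c1 c2 c3 = 0"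
      then have ord: "0 < c1" "c1 \<le> c2" "c2 \<le> c3" and prim: "gcd c1 (gcd c2 c3) = 1"
        by (auto simp: primitive_DS_triple_def DS_triple_def)
      have "(c3 - c1 - c2)\<^sup>2 = 4 * (c1 * c2)"
        using zero ord by (simp add: c4_minus_eq_0_iff)
      from primitive_square_imp_parametrized[OF ord this prim]
      obtain M N where MN: "1 \<le> M" "M \<le> N" "gcd M N = 1"
        and c: "c1 = M\<^sup>2" "c2 = N\<^sup>2" "c3 = (M + N)\<^sup>2" .
      from MN show "\<exists>M N. (c1, c2, c3) = (M\<^sup>2, N\<^sup>2, (M + N)\<^sup>2) \<and> 1 \<le> M \<and> M \<le> N \<and> gcd M N = 1"
        unfolding c by (intro exI[of _ M] exI[of _ N] conjI refl)
    qed
    show "?R \<subseteq> ?L"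
      using primitive_DS_triple_parametrized c4_minus_parametrized by auto
  qed
  show ?formula
    using c4_plus_of_c4_minus_eq_0[OF c4_minus_parametrized] by blast
qed

end
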